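(* Fix the forward feasible region $\mathcal X$, the dataset $\hat{\mathcal X}=(\hat x^1,\dots,\hat x^K)$ and the threshold $\tau$. For a dataset $\mathcal D$ of $K$ points in $\mathbb R^n$ and $\theta\in[0,1]$ let $\mathcal C(\mathcal D,\theta)$ be the set of inverse-feasible cost vectors for $\mathbf{QIO}(\mathcal D,\tau,\theta)$, and write $\hat{\mathcal C}(\theta)=\mathcal C(\hat{\mathcal X},\theta)$. Then the inverse stability measure of $\hat{\mathcal C}(\theta)$, $$\inf_{\tilde{\mathcal X}\in(\mathbb R^{n})^{K}}\{d(\hat{\mathcal X},\tilde{\mathcal X})\;:\;\hat{\mathcal C}(\theta)\cap\mathcal C(\tilde{\mathcal X},\theta)=\emptyset\},$$ is non-decreasing as $\theta$ decreases; that is, if $\theta_2\le\theta_1$ then the value of the measure at $\theta_2$ is at least its value at $\theta_1$.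
   Context: Setting: $A\in\mathbb R^{m\times n}$, $b\in\mathbb R^m$, $\mathcal I=\{1,\dots,m\}$; $a^i\in\mathbb R^n$ is the $i$-th row of $A$ written as a column vector; prime denotes transpose. The forward feasible region $\mathcal X=\{x\in\mathbb R^n: Ax\ge b\}$ is bounded, full-dimensional and free of redundant constraints. Norm parameters $\ell,p\ge1$ (possibly $\infty$) are fixed, and $\|a^i\|_p=1$ for all $i$. The dataset $\hat{\mathcal X}=\{\hat x^1,\dots,\hat x^K\}\subset\mathbb R^n$ is indexed by $\mathcal K=\{1,\dots,K\}$, with no assumption on feasibility or optimality of the points. $\tau\ge0$ and $\theta\in[0,1]$. Quantile inverse optimization problem $\mathbf{QIO}(\hat{\mathcal X},\tau,\theta)$: find $c\in\mathbb R^n$, $\{\epsilon^k\}_{k\in\mathcal K}\subset\mathbb R^n$, $y\in\mathbb R^m$, $\mathcal S\subseteq\mathcal K$ such that $A'y=c$, $y\ge0$; $A(\hat x^k-\epsilon^k)\ge b$, $c'(\hat x^k-\epsilon^k)=b'y$ and $\|\epsilon^k\|_\ell\le\tau$ for all $k\in\mathcal S$; $|\mathcal S|\ge\theta K$; and $\|c\|_p=1$. A cost vector $c$ is inverse-feasible if it is the $c$-component of such a feasible solution. $d$ is a distance function between datasets, e.g. $d(\hat{\mathcal X},\tilde{\mathcal X})=\sum_{k}\|\hat x^k-\tilde x^k\|_\ell$. The infimum of the empty set is $+\infty$. *)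

theory Defs
  imports "HOL-Analysis.Analysis"
begin

definition lp_norm :: "ereal \<Rightarrow> real ^ 'n \<Rightarrow> real" where
  "lp_norm p x =
    (if p = \<infinity> then infnorm x
     else (\<Sum>i\<in>UNIV. \<bar>x $ i\<bar> powr real_of_ereal p) powr (1 / real_of_ereal p))"

text \<open>The order on vectors is the componentwise one. The index types \<open>'m\<close>, \<open>'n\<close>, \<open>'k\<close>
  are those of the constraints, the coordinates and the data points; a dataset of
  \<open>K = CARD('k)\<close> points is a vector of points, so repeated points are allowed.\<close>

definition feasible_region :: "real ^ 'n ^ 'm \<Rightarrow> real ^ 'm \<Rightarrow> (real ^ 'n) set" where
  "feasible_region A b = {x. b \<le> A *v x}"

definition redundant_constraint :: "real ^ 'n ^ 'm \<Rightarrow> real ^ 'm \<Rightarrow> 'm \<Rightarrow> bool" where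
  "redundant_constraint A b i \<longleftrightarrow>
    {x. \<forall>j. j \<noteq> i \<longrightarrow> b $ j \<le> row j A \<bullet> x} = feasible_region A b"

definition qio_feasible ::
  "ereal \<Rightarrow> ereal \<Rightarrow> real ^ 'n ^ 'm \<Rightarrow> real ^ 'm \<Rightarrow> real ^ 'n ^ 'k \<Rightarrow> real \<Rightarrow> real \<Rightarrow>
   real ^ 'n \<Rightarrow> real ^ 'n ^ 'k \<Rightarrow> real ^ 'm \<Rightarrow> 'k set \<Rightarrow> bool" where
  "qio_feasible l p A b X \<tau> \<theta> c \<epsilon> y S \<longleftrightarrow>
    transpose A *v y = c \<and> 0 \<le> y \<and>
    (\<forall>k\<in>S. b \<le> A *v (X $ k - \<epsilon> $ k) \<and>
            c \<bullet> (X $ k - \<epsilon> $ k) = b \<bullet> y \<and>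
            lp_norm l (\<epsilon> $ k) \<le> \<tau>) \<and>
    real (card S) \<ge> \<theta> * real CARD('k) \<and>
    lp_norm p c = 1"

definition inverse_feasible ::
  "ereal \<Rightarrow> ereal \<Rightarrow> real ^ 'n ^ 'm \<Rightarrow> real ^ 'm \<Rightarrow> real ^ 'n ^ 'k \<Rightarrow> real \<Rightarrow> real \<Rightarrow>
   (real ^ 'n) set" where
  "inverse_feasible l p A b X \<tau> \<theta> = {c. \<exists>\<epsilon> y S. qio_feasible l p A b X \<tau> \<theta> c \<epsilon> y S}"

text \<open>The infimum is taken in the extended reals, where the infimum of the empty set
  is \<open>\<infinity>\<close>.\<close>

definition inverse_stability ::
  "(real ^ 'n ^ 'k \<Rightarrow> real ^ 'n ^ 'k \<Rightarrow> real) \<Rightarrow> ereal \<Rightarrow> ereal \<Rightarrow> real ^ 'n ^ 'm \<Rightarrow> real ^ 'm \<Rightarrow>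
   real ^ 'n ^ 'k \<Rightarrow> real \<Rightarrow> real \<Rightarrow> ereal" where
  "inverse_stability d l p A b X \<tau> \<theta> =
    (INF X' \<in> {X'. inverse_feasible l p A b X \<tau> \<theta> \<inter> inverse_feasible l p A b X' \<tau> \<theta> = {}}.
       ereal (d X X'))"

end

theory Submission
  imports Defs
begin

text \<open>In \<open>qio_feasible\<close>, \<theta> enters only through the lower bound on
  \<open>card S\<close>, so decreasing \<theta> enlarges the inverse-feasible set of every dataset.
  Larger sets are harder to make disjoint: the infimum at \<open>\<theta>2\<close> runs over fewer
  datasets than the one at \<open>\<theta>1\<close>.\<close>

lemma inverse_feasible_antimono:
  assumes "\<theta>2 \<le> \<theta>1"
  shows "inverse_feasible l p A b (X :: real ^ 'n ^ 'k) \<tau> \<theta>1 \<subseteq> inverse_feasible l p A b X \<tau> \<theta>2"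
proof -
  have "\<theta>2 * real CARD('k) \<le> \<theta>1 * real CARD('k)"
    using assms by (simp add: mult_right_mono)
  then show ?thesis
    \<comment> \<open>The same \<epsilon>, \<open>y\<close> and \<open>S\<close> serve for
      \<open>\<theta>2\<close>.\<close>
    unfolding inverse_feasible_def qio_feasible_def by (blast intro: order_trans)
qed

theorem proposition1:
  fixes A :: "real ^ 'n ^ 'm" and b :: "real ^ 'm" and X :: "real ^ 'n ^ 'k"
    and d :: "real ^ 'n ^ 'k \<Rightarrow> real ^ 'n ^ 'k \<Rightarrow> real"
    and l p :: ereal and \<tau> \<theta>1 \<theta>2 :: real
  assumes "1 \<le> l" and "1 \<le> p"
    and "bounded (feasible_region A b)"
    and "aff_dim (feasible_region A b) = int CARD('n)"
    and "\<And>i. \<not> redundant_constraint A b i"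
    and "\<And>i. lp_norm p (row i A) = 1"
    and "Metric_space UNIV d"
    and "0 \<le> \<tau>"
    and "\<theta>1 \<in> {0..1}" and "\<theta>2 \<in> {0..1}" and "\<theta>2 \<le> \<theta>1"
  shows "inverse_stability d l p A b X \<tau> \<theta>1 \<le> inverse_stability d l p A b X \<tau> \<theta>2"
  unfolding inverse_stability_def
  \<comment> \<open>Monotonicity is used for both \<open>X\<close> and \<open>X'\<close>: a common
    cost vector at \<open>\<theta>1\<close> is still common at \<open>\<theta>2\<close>, so
    disjointness at \<open>\<theta>2\<close> gives it at \<open>\<theta>1\<close>.\<close>
  by (rule INF_superset_mono)
    (use inverse_feasible_antimono[OF \<open>\<theta>2 \<le> \<theta>1\<close>] in blast, simp)

end
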